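(* Let $A=S\Lambda S^{-1}\in\mathbb{C}^{d\times d}$ be diagonalizable by a known eigenvector basis $S$ (an invertible matrix), with $\Lambda=\mathrm{diag}(\lambda_0,\dots,\lambda_{d-1})$, and assume that the eigenvalues are absolutely collision-free. Let $\phi\in\mathbb{C}^d$ depend on all eigenspaces of $A$, and let $y:=S^*x$ be elementwise non-zero for the unknown $x\in\mathbb{C}^d$. Then the spectrum of $A$ (as an unordered set) is determined by the samples $\{|\langle x,A^\ell\phi\rangle|\}_{\ell=0}^{2d^2-1}$ up to global phase and winding direction. That is, if $A'=S\,\mathrm{diag}(\lambda'_0,\dots,\lambda'_{d-1})S^{-1}$ and $x'\in\mathbb{C}^d$ satisfy the same hypotheses (absolutely collision-free eigenvalues $\lambda'_k$; $S^*x'$ elementwise non-zero) and $|\langle x',A'^\ell\phi\rangle|=|\langle x,A^\ell\phi\rangle|$ for all $\ell=0,\dots,2d^2-1$, then there is $\theta\in\mathbb{R}$ such that $\{\lambda'_0,\dots,\lambda'_{d-1}\}$ equals $\{e^{i\theta}\lambda_0,\dots,e^{i\theta}\lambda_{d-1}\}$ or $\{e^{i\theta}\overline{\lambda_0},\dots,e^{i\theta}\overline{\lambda_{d-1}}\}$.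
   Context: $\langle\cdot,\cdot\rangle$ is the standard inner product on $\mathbb{C}^d$; $S^*$ is the conjugate transpose. Complex numbers $\mu_0,\dots,\mu_{d-1}$ are collision-free if the $d^2$ products $\mu_j\overline{\mu_k}$, $j,k\in\{0,\dots,d-1\}$, are pairwise distinct (for distinct ordered index pairs). They are absolutely collision-free if they are collision-free and, in addition, the products $|\mu_j||\mu_k|$ for index pairs $j>k$ are pairwise distinct. The vector $\phi$ depends on all eigenspaces of $A$ if every coordinate of $S^{-1}\phi$ is non-zero. "Up to winding direction" means that the relative phases $\arg(\lambda_j\overline{\lambda_k})$ are determined only up to one common sign, i.e. up to conjugating all elements simultaneously. *)

theory Defs
  imports Complex_Main "Jordan_Normal_Form.Schur_Decomposition"
begin

(* A family mu_0, ..., mu_{d-1} is encoded as a function on nat; only its values below d matter. *)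

definition collision_free :: "nat \<Rightarrow> (nat \<Rightarrow> complex) \<Rightarrow> bool" where
  "collision_free d \<mu> \<longleftrightarrow> inj_on (\<lambda>(j, k). \<mu> j * cnj (\<mu> k)) ({..<d} \<times> {..<d})"

definition absolutely_collision_free :: "nat \<Rightarrow> (nat \<Rightarrow> complex) \<Rightarrow> bool" where
  "absolutely_collision_free d \<mu> \<longleftrightarrow>
     collision_free d \<mu> \<and>
     inj_on (\<lambda>(j, k). cmod (\<mu> j) * cmod (\<mu> k)) {(j, k). j < d \<and> k < j}"

definition elementwise_nonzero :: "complex vec \<Rightarrow> bool" where
  "elementwise_nonzero v \<longleftrightarrow> (\<forall>i < dim_vec v. v $ i \<noteq> 0)"

end

(* Expanding |<x, A^l phi>|^2 gives an exponential sum in l with non-zero coefficients whose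
   d^2 nodes are the products lam_j * cnj lam_k. Two such sums that agree for 2 d^2 values of l
   have the same nodes: otherwise a polynomial vanishing at all nodes but one isolates a
   coefficient. The real nodes are the |lam_j|^2; this matches the eigenvalues by modulus. The
   modulus of a non-real node identifies its index pair, so each product is known up to
   conjugation, and going around triangles shows that one choice serves all pairs. *)

theory Submission
  imports Defs
begin

section \<open>Nodes of exponential sums\<close>

text \<open>Weighting the equations by the coefficients of a polynomial \<open>r\<close> replaces
  each power \<open>p i ^ l\<close> by \<open>poly r (p i)\<close>. With \<open>r\<close> vanishing
  at every node except a supposedly missing one, a single non-zero term on the left would equal 0.
  The inclusion is one-sided, so it is applied twice later.\<close>

lemma exp_sums_nodes_subset:
  fixes p :: "'i \<Rightarrow> 'a::field" and q :: "'j \<Rightarrow> 'a"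
  assumes fin: "finite I" "finite J" and inj: "inj_on p I"
    and nz: "\<And>i. i \<in> I \<Longrightarrow> a i \<noteq> 0"
    and eq: "\<And>l. l < card I + card J \<Longrightarrow> (\<Sum>i\<in>I. a i * p i ^ l) = (\<Sum>j\<in>J. b j * q j ^ l)"
  shows "p ` I \<subseteq> q ` J"
proof (rule ccontr)
  assume "\<not> p ` I \<subseteq> q ` J"
  then obtain i where i: "i \<in> I" and iJ: "p i \<notin> q ` J" by blast
  define N where "N = p ` I \<union> q ` J"
  define r where "r = (\<Prod>w\<in>N - {p i}. [:- w, 1:])"
  have finN: "finite N" and iN: "p i \<in> N" using fin i by (auto simp: N_def)
  have zero: "poly r w = 0" if "w \<in> N" "w \<noteq> p i" for w
    using that finN unfolding r_def poly_prod by (intro prod_zero) auto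
  have nonzero: "poly r (p i) \<noteq> 0"
    using finN unfolding r_def poly_prod by (subst prod_zero_iff) auto
  have "degree r \<le> card (N - {p i})"
    using degree_prod_sum_le[of "N - {p i}" "\<lambda>w. [:- w, 1:]"] finN by (simp add: r_def)
  also have "\<dots> < card N" using finN iN by (rule card_Diff1_less)
  also have "\<dots> \<le> card I + card J"
    unfolding N_def using card_image_le[OF fin(1), of p] card_image_le[OF fin(2), of q]
      card_Un_le[of "p ` I" "q ` J"] by linarith
  finally have deg: "degree r < card I + card J" .
  \<comment> \<open>Only exponents up to \<open>degree r\<close> occur, so \<open>deg\<close> keeps
    every power sum within the range of \<open>eq\<close>.\<close>
  have swap: "(\<Sum>m\<in>M. c m * poly r (s m)) = (\<Sum>l\<le>degree r. coeff r l * (\<Sum>m\<in>M. c m * s m ^ l))"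
    for M and c s :: "'m \<Rightarrow> 'a"
    unfolding poly_altdef sum_distrib_left by (subst sum.swap) (simp add: ac_simps)
  have "(\<Sum>i\<in>I. a i * poly r (p i)) = (\<Sum>j\<in>J. b j * poly r (q j))"
    unfolding swap by (rule sum.cong) (use eq deg in auto)
  also have "\<dots> = 0"
    by (rule sum.neutral) (use zero iJ in \<open>force simp: N_def\<close>)
  \<comment> \<open>By injectivity no other index shares the node \<open>p i\<close>, so its
    coefficient \<open>a i\<close> cannot be cancelled.\<close>
  also have "(\<Sum>i\<in>I. a i * poly r (p i)) = (\<Sum>k\<in>I. if k = i then a i * poly r (p i) else 0)"
    by (rule sum.cong) (use zero i inj in \<open>auto simp: N_def inj_on_def\<close>)
  finally show False using nonzero nz i fin by simp
qed

section \<open>From the set of products to the spectrum\<close>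

lemma collision_freeD:
  assumes "collision_free d \<mu>" "\<mu> j * cnj (\<mu> k) = \<mu> m * cnj (\<mu> n)"
    and "j < d" "k < d" "m < d" "n < d"
  shows "j = m \<and> k = n"
  using assms(1) inj_onD[of "\<lambda>(j, k). \<mu> j * cnj (\<mu> k)" "{..<d} \<times> {..<d}" "(j, k)" "(m, n)"] assms(2-)
  by (auto simp: collision_free_def)

text \<open>Conjugation swaps the index pair, so a real off-diagonal product would be a collision
  between \<open>(j, k)\<close> and \<open>(k, j)\<close>.\<close>

lemma collision_free_not_real:
  assumes "collision_free d \<mu>" "j < d" "k < d" "j \<noteq> k"
  shows "\<mu> j * cnj (\<mu> k) \<noteq> cnj (\<mu> j * cnj (\<mu> k))"
  using collision_freeD[OF assms(1), of j k k j] assms by (auto simp: mult.commute)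

lemma absolutely_collision_free_pair:
  assumes "absolutely_collision_free d \<mu>"
    and "cmod (\<mu> j) * cmod (\<mu> k) = cmod (\<mu> m) * cmod (\<mu> n)"
    and "j < d" "k < d" "m < d" "n < d" "j \<noteq> k" "m \<noteq> n"
  shows "(j = m \<and> k = n) \<or> (j = n \<and> k = m)"
proof -
  have "inj_on (\<lambda>(j, k). cmod (\<mu> j) * cmod (\<mu> k)) {(j, k). j < d \<and> k < j}"
    using assms(1) by (simp add: absolutely_collision_free_def)
  \<comment> \<open>The definition covers pairs with the larger index first, so both pairs are
    sorted; this loses their order.\<close>
  from inj_onD[OF this, of "(max j k, min j k)" "(max m n, min m n)"]
  have "max j k = max m n \<and> min j k = min m n"
    using assms(2-) by (auto simp: max_def min_def mult.commute)
  then show ?thesis by (auto simp: max_def min_def split: if_splits)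
qed

lemma spectrum_determined_by_products:
  fixes lam lam' :: "nat \<Rightarrow> complex"
  assumes lam: "absolutely_collision_free d lam" and lam': "collision_free d lam'"
    and eq: "(\<lambda>(j, k). lam' j * cnj (lam' k)) ` ({..<d} \<times> {..<d})
           = (\<lambda>(j, k). lam j * cnj (lam k)) ` ({..<d} \<times> {..<d})"
  shows "\<exists>\<theta>::real.
    lam' ` {..<d} = (\<lambda>k. cis \<theta> * lam k) ` {..<d} \<or>
    lam' ` {..<d} = (\<lambda>k. cis \<theta> * cnj (lam k)) ` {..<d}"
proof (cases "d = 0")
  case True
  then show ?thesis by simp
next
  case False
  have cf: "collision_free d lam" using lam by (simp add: absolutely_collision_free_def)
  have products: "\<exists>m n. m < d \<and> n < d \<and> lam' j * cnj (lam' k) = lam m * cnj (lam n)"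
    if "j < d" "k < d" for j k
  proof -
    have "lam' j * cnj (lam' k) \<in> (\<lambda>(j, k). lam' j * cnj (lam' k)) ` ({..<d} \<times> {..<d})"
      using that by auto
    then show ?thesis unfolding eq by auto
  qed
  \<comment> \<open>The real products are exactly those on the diagonal; they match the moduli.\<close>
  have "\<exists>m<d. cmod (lam' j) = cmod (lam m)" if j: "j < d" for j
  proof -
    obtain m n where mn: "m < d" "n < d" "lam' j * cnj (lam' j) = lam m * cnj (lam n)"
      using products[OF j j] by blast
    then have "lam m * cnj (lam n) = cnj (lam m * cnj (lam n))"
      by (metis complex_cnj_cnj complex_cnj_mult mult.commute)
    then have "m = n" using collision_free_not_real[OF cf mn(1,2)] by blast
    with mn(3) have "(cmod (lam' j))\<^sup>2 = (cmod (lam m))\<^sup>2"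
      by (metis complex_norm_square of_real_eq_iff)
    then show ?thesis using mn(1) by auto
  qed
  then obtain \<sigma> where \<sigma>: "\<And>j. j < d \<Longrightarrow> \<sigma> j < d"
    and mod: "\<And>j. j < d \<Longrightarrow> cmod (lam' j) = cmod (lam (\<sigma> j))"
    by metis
  have inj: "inj_on \<sigma> {..<d}"
  proof (rule inj_onI)
    \<comment> \<open>Equal moduli would make two diagonal products of \<open>lam'\<close>
      collide.\<close>
    fix j k assume jk: "j \<in> {..<d}" "k \<in> {..<d}" "\<sigma> j = \<sigma> k"
    then have "cmod (lam' j) = cmod (lam' k)" using mod by simp
    then have "lam' j * cnj (lam' j) = lam' k * cnj (lam' k)"
      by (simp flip: complex_norm_square)
    with collision_freeD[OF lam'] jk show "j = k" by blast
  qed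
  then have image: "\<sigma> ` {..<d} = {..<d}"
    using \<sigma> by (intro endo_inj_surj) auto
  \<comment> \<open>Since \<open>\<sigma>\<close> is a permutation, \<open>w\<close> lists the
    products of \<open>lam\<close> reindexed to match the moduli of \<open>lam'\<close>.\<close>
  define w where "w j k = lam (\<sigma> j) * cnj (lam (\<sigma> k))" for j k
  have pair: "lam' j * cnj (lam' k) = w j k \<or> lam' j * cnj (lam' k) = cnj (w j k)"
    if j: "j < d" and k: "k < d" for j k
  proof (cases "j = k")
    case True
    then have "lam' j * cnj (lam' k) = w j k"
      using mod[OF j] by (simp add: w_def flip: complex_norm_square)
    then show ?thesis ..
  next
    case neq: False
    obtain m n where mn: "m < d" "n < d" "lam' j * cnj (lam' k) = lam m * cnj (lam n)"
      using products[OF j k] by blast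
    \<comment> \<open>Equal indices would make the product real, which is excluded off the diagonal
      of \<open>lam'\<close>.\<close>
    have "m \<noteq> n"
      using collision_free_not_real[OF lam' j k neq] mn(3) by (auto simp: mult.commute)
    moreover have "\<sigma> j \<noteq> \<sigma> k" using neq inj j k by (auto simp: inj_on_def)
    moreover have "cmod (lam (\<sigma> j)) * cmod (lam (\<sigma> k)) = cmod (lam m) * cmod (lam n)"
      using arg_cong[OF mn(3), of cmod] mod j k by (simp add: norm_mult)
    ultimately have "(\<sigma> j = m \<and> \<sigma> k = n) \<or> (\<sigma> j = n \<and> \<sigma> k = m)"
      using absolutely_collision_free_pair[OF lam] \<sigma> j k mn by blast
    then show ?thesis using mn(3) by (auto simp: w_def mult.commute)
  qed
  have w_real: "w j k \<noteq> cnj (w j k)" if "j < d" "k < d" "j \<noteq> k" for j k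
    unfolding w_def
    by (rule collision_free_not_real[OF cf]) (use that \<sigma> inj in \<open>auto simp: inj_on_def\<close>)
  show ?thesis
  proof (cases "lam' 0 = 0")
    case zero: True
    \<comment> \<open>All products with index \<open>0\<close> collide unless \<open>d = 1\<close>.\<close>
    have "d = 1"
      using collision_freeD[OF lam', of 0 0 0 1] zero False by (cases "d > 1") auto
    moreover have "\<sigma> 0 = 0" using \<sigma>[of 0] \<open>d = 1\<close> by simp
    then have "lam 0 = 0" using mod[of 0] zero \<open>d = 1\<close> by simp
    ultimately show ?thesis using zero by (simp add: lessThan_Suc)
  next
    case nz: False
    define s where "s = lam (\<sigma> 0)"
    have s: "cmod s = cmod (lam' 0)" using mod[of 0] False by (simp add: s_def)
    then have "s \<noteq> 0" using nz by auto
    have dichotomy: "(\<forall>j<d. lam' j * cnj (lam' 0) = w j 0) \<or> (\<forall>j<d. lam' j * cnj (lam' 0) = cnj (w j 0))"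
    proof (rule ccontr)
      assume "\<not> ?thesis"
      then obtain j k where j: "j < d" "lam' j * cnj (lam' 0) \<noteq> cnj (w j 0)"
        and k: "k < d" "lam' k * cnj (lam' 0) \<noteq> w k 0" by blast
      have j0: "lam' j * cnj (lam' 0) = w j 0" and k0: "lam' k * cnj (lam' 0) = cnj (w k 0)"
        using pair[of j 0] pair[of k 0] j k False by auto
      have real: "cnj (w 0 0) = w 0 0" by (simp add: w_def)
      \<comment> \<open>At index 0 both alternatives coincide because \<open>w 0 0\<close> is real;
        \<open>j = k\<close> would set \<open>j0\<close> against the choice of
        \<open>k\<close>.\<close>
      have neq: "j \<noteq> 0" "k \<noteq> 0" "j \<noteq> k"
        using j(2) k(2) j0 k0 real by metis+
      have wj: "w j 0 \<noteq> cnj (w j 0)" and wk: "w k 0 \<noteq> cnj (w k 0)"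
        using w_real j(1) k(1) neq by auto
      \<comment> \<open>Around the triangle \<open>0, j, k\<close> the phases cancel, so the third pair admits neither sign.\<close>
      have norm: "lam' 0 * cnj (lam' 0) = s * cnj s" using s by (simp flip: complex_norm_square)
      have "(lam' j * cnj (lam' k)) * (s * cnj s) = (lam' j * cnj (lam' 0)) * cnj (lam' k * cnj (lam' 0))"
        unfolding norm[symmetric] by simp
      also have "\<dots> = w j 0 * w k 0" unfolding j0 k0 by simp
      finally have t: "(lam' j * cnj (lam' k)) * (s * cnj s) = w j 0 * w k 0" .
      have u: "w j k * (s * cnj s) = w j 0 * cnj (w k 0)" by (simp add: w_def s_def)
      have "cnj (w j k) * (s * cnj s) = cnj (w j 0) * w k 0" by (simp add: w_def s_def)
      with t u pair[OF j(1) k(1)] have "w j 0 * w k 0 = w j 0 * cnj (w k 0) \<or> w j 0 * w k 0 = cnj (w j 0) * w k 0"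
        by auto
      \<comment> \<open>Cancelling \<open>w j 0\<close> or \<open>w k 0\<close>, non-zero because
        non-real, would make the other one real.\<close>
      then show False using wj wk by auto
    qed
    \<comment> \<open>Solving the equations of \<open>dichotomy\<close> for \<open>lam' j\<close>
      gives a factor independent of \<open>j\<close>: \<open>cnj s / cnj (lam' 0)\<close> in the
      first case, \<open>s / cnj (lam' 0)\<close> in the conjugate one.\<close>
    have phase: "\<exists>\<theta>. z / cnj (lam' 0) = cis \<theta>" if "cmod z = cmod s" for z
    proof -
      have "cmod (z / cnj (lam' 0)) = 1" using that s nz by (simp add: norm_divide)
      then have "z / cnj (lam' 0) = cis (Arg (z / cnj (lam' 0)))"
        using rcis_cmod_Arg[of "z / cnj (lam' 0)"] by (simp add: rcis_def)
      then show ?thesis ..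
    qed
    from dichotomy show ?thesis
    proof
      assume h: "\<forall>j<d. lam' j * cnj (lam' 0) = w j 0"
      obtain \<theta> where \<theta>: "cnj s / cnj (lam' 0) = cis \<theta>" using phase[of "cnj s"] by auto
      have "lam' j = cis \<theta> * lam (\<sigma> j)" if "j < d" for j
        using h that nz by (simp add: w_def s_def field_simps flip: \<theta>)
      then have "lam' ` {..<d} = (\<lambda>k. cis \<theta> * lam k) ` \<sigma> ` {..<d}"
        unfolding image_image by (intro image_cong) auto
      then show ?thesis unfolding image by blast
    next
      assume h: "\<forall>j<d. lam' j * cnj (lam' 0) = cnj (w j 0)"
      obtain \<theta> where \<theta>: "s / cnj (lam' 0) = cis \<theta>" using phase[of s] by auto
      have "lam' j = cis \<theta> * cnj (lam (\<sigma> j))" if "j < d" for j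
        using h that nz by (simp add: w_def s_def field_simps flip: \<theta>)
      then have "lam' ` {..<d} = (\<lambda>k. cis \<theta> * cnj (lam k)) ` \<sigma> ` {..<d}"
        unfolding image_image by (intro image_cong) auto
      then show ?thesis unfolding image by blast
    qed
  qed
qed

section \<open>Samples as exponential sums\<close>

text \<open>Similarity passes to powers, and powers of a diagonal matrix are taken
  entrywise.\<close>

lemma diagonalized_pow_mult_vec:
  fixes S Sinv :: "'a::comm_ring_1 mat"
  assumes S: "S \<in> carrier_mat d d"
    and Sinv: "Sinv \<in> carrier_mat d d" "inverts_mat S Sinv" "inverts_mat Sinv S"
    and v: "v \<in> carrier_vec d"
  shows "((S * mat_diag d f * Sinv) ^\<^sub>m l) *\<^sub>v v = S *\<^sub>v vec d (\<lambda>k. f k ^ l * (Sinv *\<^sub>v v) $ k)"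
proof -
  have SS: "S * Sinv = 1\<^sub>m d" "Sinv * S = 1\<^sub>m d"
    using S Sinv by (auto simp: inverts_mat_def)
  have "similar_mat_wit (S * mat_diag d f * Sinv) (mat_diag d f) S Sinv"
    using S Sinv SS by (intro similar_mat_witI[of _ _ d]) auto
  from similar_mat_wit_pow[OF this, of l]
  have "(S * mat_diag d f * Sinv) ^\<^sub>m l = S * (mat_diag d f ^\<^sub>m l) * Sinv"
    by (simp add: similar_mat_wit_def Let_def)
  also have "mat_diag d f ^\<^sub>m l = mat_diag d (\<lambda>k. f k ^ l)"
    by (induction l) (simp_all add: mult.commute, simp add: mat_diag_def)
  also have "(S * mat_diag d (\<lambda>k. f k ^ l) * Sinv) *\<^sub>v v = S *\<^sub>v (mat_diag d (\<lambda>k. f k ^ l) *\<^sub>v (Sinv *\<^sub>v v))"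
    using S Sinv v by (simp add: assoc_mult_mat_vec[of _ d d _ d])
  also have "mat_diag d (\<lambda>k. f k ^ l) *\<^sub>v (Sinv *\<^sub>v v) = vec d (\<lambda>k. f k ^ l * (Sinv *\<^sub>v v) $ k)"
  proof (rule eq_vecI)
    fix i assume "i < dim_vec (vec d (\<lambda>k. f k ^ l * (Sinv *\<^sub>v v) $ k))"
    then have i: "i < d" by simp
    then have "(mat_diag d (\<lambda>k. f k ^ l) *\<^sub>v (Sinv *\<^sub>v v)) $ i
      = (\<Sum>k<d. (if i = k then f k ^ l else 0) * (Sinv *\<^sub>v v) $ k)"
      using Sinv by (simp add: mat_diag_def scalar_prod_def lessThan_atLeast0)
    also have "\<dots> = (\<Sum>k<d. if k = i then f k ^ l * (Sinv *\<^sub>v v) $ k else 0)"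
      by (rule sum.cong) auto
    finally show "(mat_diag d (\<lambda>k. f k ^ l) *\<^sub>v (Sinv *\<^sub>v v)) $ i = vec d (\<lambda>k. f k ^ l * (Sinv *\<^sub>v v) $ k) $ i"
      using i by simp
  qed (simp add: mat_diag_def)
  finally show ?thesis .
qed

text \<open>This moves \<open>S\<close> to the other side as its adjoint, which brings in the vector
  \<open>y\<close> = \<open>mat_adjoint S *\<^sub>v x\<close>. The product \<open>\<bullet>c\<close>
  conjugates its second argument, hence \<open>cnj (g k)\<close>.\<close>

lemma cscalar_prod_mult_mat_vec:
  fixes S :: "complex mat"
  assumes S: "S \<in> carrier_mat d n" and x: "x \<in> carrier_vec d"
  shows "x \<bullet>c (S *\<^sub>v vec n g) = (\<Sum>k<n. (mat_adjoint S *\<^sub>v x) $ k * cnj (g k))"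
proof -
  have adj: "(mat_adjoint S *\<^sub>v x) $ k = (\<Sum>i<d. cnj (S $$ (i, k)) * x $ i)" if "k < n" for k
    using that S x by (simp add: mat_adjoint_def scalar_prod_def lessThan_atLeast0)
  have "x \<bullet>c (S *\<^sub>v vec n g) = (\<Sum>i<d. \<Sum>k<n. x $ i * (cnj (S $$ (i, k)) * cnj (g k)))"
    using S x by (simp add: scalar_prod_def lessThan_atLeast0 sum_distrib_left)
  also have "\<dots> = (\<Sum>k<n. (mat_adjoint S *\<^sub>v x) $ k * cnj (g k))"
    by (subst sum.swap) (simp add: adj sum_distrib_left mult_ac)
  finally show ?thesis .
qed

lemma sample_square_as_exp_sum:
  fixes S Sinv :: "complex mat" and x \<phi> :: "complex vec" and lam :: "nat \<Rightarrow> complex"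
  assumes S: "S \<in> carrier_mat d d"
    and Sinv: "Sinv \<in> carrier_mat d d" "inverts_mat S Sinv" "inverts_mat Sinv S"
    and \<phi>: "\<phi> \<in> carrier_vec d" "elementwise_nonzero (Sinv *\<^sub>v \<phi>)"
    and x: "x \<in> carrier_vec d" "elementwise_nonzero (mat_adjoint S *\<^sub>v x)"
  obtains a where "\<And>p. p \<in> {..<d} \<times> {..<d} \<Longrightarrow> a p \<noteq> 0"
    and "\<And>l. complex_of_real ((cmod (x \<bullet>c (((S * mat_diag d lam * Sinv) ^\<^sub>m l) *\<^sub>v \<phi>)))\<^sup>2)
      = (\<Sum>p\<in>{..<d} \<times> {..<d}. a p * (case p of (j, k) \<Rightarrow> lam j * cnj (lam k)) ^ l)"
proof
  define b where "b k = (mat_adjoint S *\<^sub>v x) $ k * cnj ((Sinv *\<^sub>v \<phi>) $ k)" for k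
  \<comment> \<open>The sample is a sum of \<open>b k * cnj (lam k) ^ l\<close>, so
    \<open>lam j\<close> comes from its conjugate, which contributes
    \<open>cnj (b j)\<close>.\<close>
  define a where "a = (\<lambda>(j, k). cnj (b j) * b k)"
  \<comment> \<open>One factor is non-zero by the hypothesis on \<open>x\<close>, the other because
    \<open>\<phi>\<close> depends on all eigenspaces.\<close>
  have "b k \<noteq> 0" if "k < d" for k
    using that \<phi> x S Sinv by (auto simp: b_def elementwise_nonzero_def mat_adjoint_def)
  then show "a p \<noteq> 0" if "p \<in> {..<d} \<times> {..<d}" for p using that by (auto simp: a_def)
  fix l
  define z where "z = x \<bullet>c (((S * mat_diag d lam * Sinv) ^\<^sub>m l) *\<^sub>v \<phi>)"
  have z: "z = (\<Sum>k<d. b k * cnj (lam k) ^ l)"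
    unfolding z_def diagonalized_pow_mult_vec[OF S Sinv \<phi>(1)] cscalar_prod_mult_mat_vec[OF S x(1)]
    by (simp add: b_def mult_ac)
  have "complex_of_real ((cmod z)\<^sup>2) = cnj z * z"
    by (metis complex_norm_square mult.commute)
  also have "\<dots> = (\<Sum>j<d. \<Sum>k<d. (cnj (b j) * lam j ^ l) * (b k * cnj (lam k) ^ l))"
    unfolding z by (simp add: sum_product)
  also have "\<dots> = (\<Sum>p\<in>{..<d} \<times> {..<d}. a p * (case p of (j, k) \<Rightarrow> lam j * cnj (lam k)) ^ l)"
    by (simp add: a_def sum.cartesian_product power_mult_distrib mult_ac case_prod_unfold)
  finally show "complex_of_real ((cmod (x \<bullet>c (((S * mat_diag d lam * Sinv) ^\<^sub>m l) *\<^sub>v \<phi>)))\<^sup>2)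
      = (\<Sum>p\<in>{..<d} \<times> {..<d}. a p * (case p of (j, k) \<Rightarrow> lam j * cnj (lam k)) ^ l)"
    unfolding z_def .
qed

theorem theorem6p1:
  fixes d :: nat
    and S Sinv A A' :: "complex mat"
    and lam lam' :: "nat \<Rightarrow> complex"
    and \<phi> x x' :: "complex vec"
  assumes S: "S \<in> carrier_mat d d"
    and Sinv: "Sinv \<in> carrier_mat d d" "inverts_mat S Sinv" "inverts_mat Sinv S"
    and \<phi>: "\<phi> \<in> carrier_vec d" "elementwise_nonzero (Sinv *\<^sub>v \<phi>)"
    and A: "A = S * mat_diag d lam * Sinv"
    and lam: "absolutely_collision_free d lam"
    and x: "x \<in> carrier_vec d" "elementwise_nonzero (mat_adjoint S *\<^sub>v x)"
    and A': "A' = S * mat_diag d lam' * Sinv"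
    and lam': "absolutely_collision_free d lam'"
    and x': "x' \<in> carrier_vec d" "elementwise_nonzero (mat_adjoint S *\<^sub>v x')"
    and samples: "\<And>l. l < 2 * d\<^sup>2 \<Longrightarrow>
      cmod (x' \<bullet>c ((A' ^\<^sub>m l) *\<^sub>v \<phi>)) = cmod (x \<bullet>c ((A ^\<^sub>m l) *\<^sub>v \<phi>))"
  shows "\<exists>\<theta>::real.
    lam' ` {..<d} = (\<lambda>k. cis \<theta> * lam k) ` {..<d} \<or>
    lam' ` {..<d} = (\<lambda>k. cis \<theta> * cnj (lam k)) ` {..<d}"
proof -
  define P where "P = {..<d} \<times> {..<d}"
  obtain a where a: "\<And>p. p \<in> P \<Longrightarrow> a p \<noteq> 0"
    "\<And>l. complex_of_real ((cmod (x \<bullet>c ((A ^\<^sub>m l) *\<^sub>v \<phi>)))\<^sup>2)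
      = (\<Sum>p\<in>P. a p * (case p of (j, k) \<Rightarrow> lam j * cnj (lam k)) ^ l)"
    unfolding A P_def by (rule sample_square_as_exp_sum[OF S Sinv \<phi> x, where lam = lam]) blast
  obtain a' where a': "\<And>p. p \<in> P \<Longrightarrow> a' p \<noteq> 0"
    "\<And>l. complex_of_real ((cmod (x' \<bullet>c ((A' ^\<^sub>m l) *\<^sub>v \<phi>)))\<^sup>2)
      = (\<Sum>p\<in>P. a' p * (case p of (j, k) \<Rightarrow> lam' j * cnj (lam' k)) ^ l)"
    unfolding A' P_def by (rule sample_square_as_exp_sum[OF S Sinv \<phi> x', where lam = lam']) blast
  \<comment> \<open>The number of samples comes from here: each of the two sums has
    \<open>card P\<close> nodes.\<close>
  have fin: "finite P" and card: "card P + card P = 2 * d\<^sup>2"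
    by (simp_all add: P_def power2_eq_square)
  have eq: "(\<Sum>p\<in>P. a' p * (case p of (j, k) \<Rightarrow> lam' j * cnj (lam' k)) ^ l)
    = (\<Sum>p\<in>P. a p * (case p of (j, k) \<Rightarrow> lam j * cnj (lam k)) ^ l)"
    if "l < card P + card P" for l
    using that samples[of l] unfolding card by (simp flip: a(2) a'(2))
  have cf: "collision_free d lam" and cf': "collision_free d lam'"
    using lam lam' by (simp_all add: absolutely_collision_free_def)
  \<comment> \<open>Each inclusion uses that the family on its left is collision-free and has
    non-zero coefficients.\<close>
  have "(\<lambda>(j, k). lam' j * cnj (lam' k)) ` P = (\<lambda>(j, k). lam j * cnj (lam k)) ` P"
    using exp_sums_nodes_subset[OF fin fin cf'[unfolded collision_free_def, folded P_def] a'(1) eq]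
      exp_sums_nodes_subset[OF fin fin cf[unfolded collision_free_def, folded P_def] a(1) eq[symmetric]]
    by blast
  then show ?thesis
    unfolding P_def by (rule spectrum_determined_by_products[OF lam cf'])
qed

end
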